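(* Let $P=(p^{(1)},\dots,p^{(n)})$ and $Q=(q^{(1)},\dots,q^{(n)})$ be matrices in $\mathbb{R}^{d\times n}$ with columns $p^{(i)},q^{(i)}\in\mathbb{R}^d$, and let $p\in[2,\infty]$. Let $(A^*,t^*,s^* )$ be a minimizer of $\mathrm{E}_p(A,t,s)$ over $A\in\mathbb{R}^{d\times d}$, $t,s\in\mathbb{R}^d$. Let $\hat R=\Pi(A^* )$ and let $\hat t$ be a minimizer of $t\mapsto \mathrm{E}(\hat R,t)$ over $t\in\mathbb{R}^d$. Let $\mathrm{E}^*=\min_{R\in O(d),\,t\in\mathbb{R}^d}\mathrm{E}(R,t)$. Then $$\mathrm{E}^*\le \mathrm{E}(\hat R,\hat t)\le 2\sqrt2\,\mathrm{E}_p(A^*,t^*,s^* )\le 2\sqrt2\,\mathrm{E}^*.$$ Moreover, if $p=2$ then $$\mathrm{E}^*\le \mathrm{E}(\hat R,\hat t)\le \sqrt2\,\mathrm{E}_2(A^*,t^*,s^* )\le \sqrt2\,\mathrm{E}^*.$$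
   Context: $\|\cdot\|$ is the Euclidean norm and $O(d)$ is the set of $d\times d$ real orthogonal matrices. For $R\in O(d)$, $t\in\mathbb{R}^d$, $\mathrm{E}(R,t)=\sum_{i=1}^n\|Rp^{(i)}-q^{(i)}+t\|$. For $A\in\mathbb{R}^{d\times d}$, $t,s\in\mathbb{R}^d$ and $1\le p<\infty$, $$\mathrm{E}_p(A,t,s)=\sum_{i=1}^n\left(\frac{\|Ap^{(i)}-q^{(i)}+t\|^p+\|A^Tq^{(i)}-p^{(i)}+s\|^p}{2}\right)^{1/p},$$ and $\mathrm{E}_\infty(A,t,s)=\sum_{i=1}^n\max\{\|Ap^{(i)}-q^{(i)}+t\|,\|A^Tq^{(i)}-p^{(i)}+s\|\}$. For $A\in\mathbb{R}^{d\times d}$, $\Pi(A)=UV^T\in O(d)$, where $A=U\Sigma V^T$ is a singular value decomposition of $A$ ($U,V\in O(d)$, $\Sigma$ diagonal with nonnegative entries); any choice of SVD is allowed. *)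

theory Defs
  imports "HOL-Analysis.Analysis"
begin

definition E :: "real^'n^'d \<Rightarrow> real^'n^'d \<Rightarrow> real^'d^'d \<Rightarrow> real^'d \<Rightarrow> real" where
  "E P Q R t = (\<Sum>i\<in>UNIV. norm (R *v column i P - column i Q + t))"

text \<open>The exponent ranges over the extended reals, so that one family covers the finite
  exponents (intended for \<open>1 \<le> p\<close>) and \<open>p = \<infinity>\<close>. The bases of \<open>powr\<close> are nonnegative and
  \<open>0 powr p = 0\<close>, as required.\<close>

definition E_p :: "ereal \<Rightarrow> real^'n^'d \<Rightarrow> real^'n^'d \<Rightarrow> real^'d^'d \<Rightarrow> real^'d \<Rightarrow> real^'d \<Rightarrow> real"
  where
  "E_p p P Q A t s =
    (if p = \<infinity>
     then \<Sum>i\<in>UNIV. max (norm (A *v column i P - column i Q + t))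
                       (norm (transpose A *v column i Q - column i P + s))
     else let r = real_of_ereal p in
       \<Sum>i\<in>UNIV. ((norm (A *v column i P - column i Q + t) powr r
                 + norm (transpose A *v column i Q - column i P + s) powr r) / 2) powr (1 / r))"

definition is_svd :: "real^'d^'d \<Rightarrow> real^'d^'d \<Rightarrow> real^'d^'d \<Rightarrow> real^'d^'d \<Rightarrow> bool" where
  "is_svd A U S V \<longleftrightarrow>
     orthogonal_matrix U \<and> orthogonal_matrix V \<and>
     (\<forall>i j. i \<noteq> j \<longrightarrow> S $ i $ j = 0) \<and> (\<forall>i. 0 \<le> S $ i $ i) \<and>
     A = U ** S ** transpose V"

text \<open>A relation rather than a function: for singular \<open>A\<close> the product \<open>U V\<^sup>T\<close> depends on the
  chosen singular value decomposition, and every choice is allowed.\<close>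

definition is_Pi :: "real^'d^'d \<Rightarrow> real^'d^'d \<Rightarrow> bool" where
  "is_Pi A R \<longleftrightarrow> (\<exists>U S V. is_svd A U S V \<and> R = U ** transpose V)"

definition E_star :: "real^'n^'d \<Rightarrow> real^'n^'d \<Rightarrow> real" where
  "E_star P Q = (INF (R, t) \<in> {R. orthogonal_matrix R} \<times> UNIV. E P Q R t)"

text \<open>The infimum defining \<open>E_star\<close> is a minimum.\<close>

lemma compact_orthogonal_matrices: "compact {R :: real^'d^'d. orthogonal_matrix R}"
proof -
  have entry: "\<bar>R $ i $ j\<bar> \<le> 1" if R: "orthogonal_matrix R" for R :: "real^'d^'d" and i j
  proof -
    have "norm (row i R) = 1"
      using R orthogonal_matrix_orthonormal_rows by blast
    then show ?thesis
      using component_le_norm_cart[of "row i R" j] by (simp add: row_def)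
  qed
  have "norm R \<le> real (CARD('d) * CARD('d))" if R: "orthogonal_matrix R" for R :: "real^'d^'d"
  proof -
    have "norm (R $ i) \<le> real CARD('d)" for i
    proof -
      have "norm (R $ i) \<le> (\<Sum>j\<in>UNIV. \<bar>R $ i $ j\<bar>)"
        by (rule norm_le_l1_cart)
      also have "\<dots> \<le> (\<Sum>j\<in>(UNIV :: 'd set). 1)"
        by (rule sum_mono) (use entry[OF R] in auto)
      finally show ?thesis by simp
    qed
    then have "(\<Sum>i\<in>UNIV. norm (R $ i)) \<le> (\<Sum>i\<in>(UNIV :: 'd set). real CARD('d))"
      by (intro sum_mono)
    moreover have "norm R \<le> (\<Sum>i\<in>UNIV. norm (R $ i))"
      unfolding norm_vec_def by (rule L2_set_le_sum) simp
    ultimately show ?thesis by simp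
  qed
  then have "bounded {R :: real^'d^'d. orthogonal_matrix R}"
    by (intro boundedI) auto
  moreover have "closed {R :: real^'d^'d. orthogonal_matrix R}"
    unfolding orthogonal_matrix transpose_def matrix_matrix_mult_def
    by (intro closed_Collect_eq continuous_intros)
  ultimately show ?thesis
    by (simp add: compact_eq_bounded_closed)
qed

lemma E_star_attained:
  fixes P Q :: "real^'n^'d"
  obtains R t where "orthogonal_matrix R" "E P Q R t = E_star P Q"
    and "\<And>R' t'. orthogonal_matrix R' \<Longrightarrow> E P Q R t \<le> E P Q R' t'"
proof -
  fix i0 :: 'n
  define p where "p = column i0 P"
  define q where "q = column i0 Q"
  define B where "B = E P Q (mat 1) 0 + norm p + norm q"
  let ?O = "{R :: real^'d^'d. orthogonal_matrix R}"
  let ?K = "?O \<times> cball (0 :: real^'d) B"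
  have nonneg: "0 \<le> E P Q R t" for R t
    unfolding E_def by (simp add: sum_nonneg)
  have id: "mat 1 \<in> ?O" by (simp add: orthogonal_matrix_id)
  have "0 \<le> B" unfolding B_def using nonneg by simp
  then have idK: "(mat 1, 0) \<in> ?K" using id by simp
  have "continuous_on ?K (\<lambda>x. E P Q (fst x) (snd x))"
    unfolding E_def matrix_vector_mult_def by (intro continuous_intros)
  moreover have "compact ?K"
    by (intro compact_Times compact_orthogonal_matrices compact_cball)
  ultimately obtain x where xK: "x \<in> ?K"
    and xmin: "\<And>y. y \<in> ?K \<Longrightarrow> E P Q (fst x) (snd x) \<le> E P Q (fst y) (snd y)"
    using continuous_attains_inf[of ?K "\<lambda>x. E P Q (fst x) (snd x)"] idK by blast
  have min: "E P Q (fst x) (snd x) \<le> E P Q R t" if R: "orthogonal_matrix R" for R t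
  proof (cases "norm t \<le> B")
    case True
    then show ?thesis using xmin[of "(R, t)"] R by simp
  next
    case False
    have "norm (R *v p) = norm p"
      using R orthogonal_transformation_matrix[of "(*v) R"]
      by (simp add: orthogonal_transformation_norm)
    moreover have "norm t \<le> norm (R *v p - q + t) + norm (R *v p) + norm q"
      using norm_triangle_ineq[of "(R *v p - q + t) - R *v p" q]
        norm_triangle_ineq4[of "R *v p - q + t" "R *v p"] by simp
    moreover have "norm (R *v p - q + t) \<le> E P Q R t"
      unfolding E_def p_def q_def by (rule member_le_sum) auto
    ultimately have "E P Q (mat 1) 0 \<le> E P Q R t"
      using False unfolding B_def by linarith
    then show ?thesis using xmin[OF idK] by simp
  qed
  have orth: "orthogonal_matrix (fst x)" using xK by auto
  have "E_star P Q = E P Q (fst x) (snd x)"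
    unfolding E_star_def
  proof (rule cInf_eq_minimum)
    show "E P Q (fst x) (snd x) \<in> (\<lambda>(R, t). E P Q R t) ` (?O \<times> UNIV)"
      using orth by (auto intro!: image_eqI[of _ _ x] simp: mem_Times_iff split: prod.splits)
  qed (use min in auto)
  with orth min show ?thesis
    by (intro that[of "fst x" "snd x"]) auto
qed

end

theory Submission
  imports Defs
begin

text \<open>
  Write \<open>r\<^sub>i = (a\<^sub>i, b\<^sub>i)\<close> for the pair of residuals of \<open>(A, t, s)\<close> at the \<open>i\<close>-th points. In the
  singular bases of \<open>A\<close>, the shift \<open>T\<close> with coordinates \<open>(t\<^sub>j - s\<^sub>j) / (1 + \<sigma>\<^sub>j)\<close> turns the residual
  \<open>e\<^sub>i\<close> of \<open>(\<Pi> A, T)\<close> into the vector with coordinates \<open>(a\<^sub>i\<^sub>j - b\<^sub>i\<^sub>j) / (1 + \<sigma>\<^sub>j)\<close>. Hence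
  \<open>\<parallel>e\<^sub>i\<parallel> \<le> \<surd>2 \<parallel>r\<^sub>i\<parallel>\<close>, and \<open>\<parallel>r\<^sub>i\<parallel>\<close> is at most twice the \<open>p\<close>-mean of \<open>\<parallel>a\<^sub>i\<parallel>\<close> and \<open>\<parallel>b\<^sub>i\<parallel>\<close>
  for \<open>p \<ge> 2\<close>.

  For \<open>p = 2\<close>, the functional is a multiple of \<open>\<Sum>i. \<parallel>r\<^sub>i\<parallel>\<close>, and stationarity in the direction of
  the singular value \<open>\<sigma>\<^sub>j\<close> yields, with weights \<open>w\<^sub>i = 1 / \<parallel>r\<^sub>i\<parallel>\<close>, the improved inequality
  \<open>\<Sum>i. w\<^sub>i \<parallel>e\<^sub>i\<parallel>\<^sup>2 \<le> \<Sum>i. w\<^sub>i \<parallel>r\<^sub>i\<parallel>\<^sup>2\<close>. Since \<open>2 \<parallel>e\<^sub>i\<parallel> \<le> w\<^sub>i \<parallel>e\<^sub>i\<parallel>\<^sup>2 + \<parallel>r\<^sub>i\<parallel>\<close>, this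
  bounds \<open>\<Sum>i. \<parallel>e\<^sub>i\<parallel>\<close> by \<open>\<Sum>i. \<parallel>r\<^sub>i\<parallel>\<close>. Points with \<open>r\<^sub>i = 0\<close> have weight \<open>0\<close>; the variation is
  centred so that it keeps their residuals equal to \<open>0\<close>.
\<close>

section \<open>Reweighted least squares\<close>

lemma linear_coeff_eq_0_if_quadratic_nonneg:
  fixes b c :: real
  assumes nonneg: "\<And>h. 0 \<le> b * h + c * h\<^sup>2"
  shows "b = 0"
proof -
  have c: "0 \<le> c" using nonneg[of 1] nonneg[of "-1"] by simp
  \<comment> \<open>The vertex would be \<open>- b / (2 * c)\<close>; the denominator
    \<open>1 + c\<close> also covers \<open>c = 0\<close> and still gives a negative value unless
    \<open>b = 0\<close>.\<close>
  have "0 \<le> b * (- b / (1 + c)) + c * (- b / (1 + c))\<^sup>2" by (rule nonneg)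
  also have "\<dots> = - (b\<^sup>2) / (1 + c)\<^sup>2"
  proof -
    have "b * (- b / k) + c * (- b / k)\<^sup>2 = (c - k) * b\<^sup>2 / k\<^sup>2" if "k \<noteq> 0" for k
      using that by (simp add: field_simps power2_eq_square)
    from this[of "1 + c"] show ?thesis using c by simp
  qed
  finally show ?thesis using c by (simp add: divide_le_0_iff)
qed

lemma twice_norm_le_weighted:
  fixes x :: "'a::real_normed_vector" and y :: "'b::real_normed_vector"
  assumes "x \<noteq> 0"
  shows "2 * norm y \<le> norm x + (norm y)\<^sup>2 / norm x"
proof -
  have "0 \<le> (norm x - norm y)\<^sup>2 / norm x" by simp
  then show ?thesis using assms by (simp add: power2_diff field_simps power2_eq_square)
qed

text \<open>A first-order condition without derivatives: each norm has a quadratic majorant in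
  \<open>h\<close> touching it at \<open>h = 0\<close>, so minimality makes the summed increment
  nonnegative. By \<open>zero\<close>, terms with \<open>r i = 0\<close> stay constant in
  \<open>h\<close>.\<close>

lemma stationary_sum_norm:
  fixes r \<delta> :: "'i \<Rightarrow> 'a::real_inner"
  assumes min: "\<And>h. (\<Sum>i\<in>I. norm (r i)) \<le> (\<Sum>i\<in>I. norm (r i + h *\<^sub>R \<delta> i))"
    and zero: "\<And>i. r i = 0 \<Longrightarrow> \<delta> i = 0"
  shows "(\<Sum>i\<in>I. inner (r i) (\<delta> i) / norm (r i)) = 0"
proof -
  let ?b = "\<Sum>i\<in>I. inner (r i) (\<delta> i) / norm (r i)"
  let ?c = "\<Sum>i\<in>I. (norm (\<delta> i))\<^sup>2 / norm (r i)"
  have "0 \<le> 2 * ?b * h + ?c * h\<^sup>2" for h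
  proof -
    have "2 * norm (r i + h *\<^sub>R \<delta> i) \<le> 2 * norm (r i)
        + (2 * (inner (r i) (\<delta> i) / norm (r i)) * h + ((norm (\<delta> i))\<^sup>2 / norm (r i)) * h\<^sup>2)" for i
    proof (cases "r i = 0")
      case True
      then show ?thesis using zero by simp
    next
      case False
      have "(norm (r i + h *\<^sub>R \<delta> i))\<^sup>2
          = (norm (r i))\<^sup>2 + 2 * h * inner (r i) (\<delta> i) + h\<^sup>2 * (norm (\<delta> i))\<^sup>2"
        unfolding power2_norm_eq_inner
        by (simp add: inner_add_left inner_add_right inner_commute power2_eq_square algebra_simps)
      then show ?thesis
        using twice_norm_le_weighted[OF False, of "r i + h *\<^sub>R \<delta> i"] False
        by (simp add: add_divide_distrib power2_eq_square algebra_simps)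
    qed
    then have "(\<Sum>i\<in>I. 2 * norm (r i + h *\<^sub>R \<delta> i)) \<le> (\<Sum>i\<in>I. 2 * norm (r i)
        + (2 * (inner (r i) (\<delta> i) / norm (r i)) * h + ((norm (\<delta> i))\<^sup>2 / norm (r i)) * h\<^sup>2))"
      by (intro sum_mono)
    also have "\<dots> = 2 * (\<Sum>i\<in>I. norm (r i)) + (2 * ?b * h + ?c * h\<^sup>2)"
      by (simp add: sum.distrib sum_distrib_left sum_distrib_right)
    finally show ?thesis
      using min[of h] by (simp flip: sum_distrib_left)
  qed
  then have "2 * ?b = 0" by (rule linear_coeff_eq_0_if_quadratic_nonneg)
  then show ?thesis by simp
qed

lemma sum_norm_le_if_weighted_le:
  fixes e :: "'i \<Rightarrow> 'a::real_normed_vector" and r :: "'i \<Rightarrow> 'b::real_normed_vector"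
  assumes le: "(\<Sum>i\<in>I. (norm (e i))\<^sup>2 / norm (r i)) \<le> (\<Sum>i\<in>I. (norm (r i))\<^sup>2 / norm (r i))"
    and zero: "\<And>i. r i = 0 \<Longrightarrow> e i = 0"
  shows "(\<Sum>i\<in>I. norm (e i)) \<le> (\<Sum>i\<in>I. norm (r i))"
proof -
  have "2 * norm (e i) \<le> norm (r i) + (norm (e i))\<^sup>2 / norm (r i)" for i
  proof (cases "r i = 0")
    case True
    then show ?thesis using zero by simp
  next
    case False
    then show ?thesis by (rule twice_norm_le_weighted)
  qed
  then have "(\<Sum>i\<in>I. 2 * norm (e i)) \<le> (\<Sum>i\<in>I. norm (r i) + (norm (e i))\<^sup>2 / norm (r i))"
    by (intro sum_mono)
  also have "\<dots> \<le> (\<Sum>i\<in>I. norm (r i)) + (\<Sum>i\<in>I. (norm (r i))\<^sup>2 / norm (r i))"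
    using le by (simp add: sum.distrib)
  also have "(\<Sum>i\<in>I. (norm (r i))\<^sup>2 / norm (r i)) = (\<Sum>i\<in>I. norm (r i))"
    by (intro sum.cong) (auto simp: power2_eq_square)
  finally show ?thesis by (simp flip: sum_distrib_left)
qed

text \<open>With \<open>S\<close> and \<open>C\<close> as in the proof, stationarity reads
  \<open>\<sigma> * S = 2 * C\<close>. The left side is then \<open>S - \<sigma> * S\<close>, and
  the right side exceeds it by \<open>\<sigma>\<close> times the left side.\<close>

lemma stationary_weighted_le:
  fixes x y w :: "'i \<Rightarrow> real"
  assumes stat: "(\<Sum>i\<in>I. w i * ((\<sigma> * x i - y i) * x i + (\<sigma> * y i - x i) * y i)) = 0"
    and "0 \<le> \<sigma>" and w: "\<And>i. 0 \<le> w i"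
  shows "(\<Sum>i\<in>I. w i * (x i - y i)\<^sup>2)
    \<le> (\<Sum>i\<in>I. w i * ((\<sigma> * x i - y i)\<^sup>2 + (\<sigma> * y i - x i)\<^sup>2))"
proof -
  define S where "S = (\<Sum>i\<in>I. w i * ((x i)\<^sup>2 + (y i)\<^sup>2))"
  define C where "C = (\<Sum>i\<in>I. w i * (x i * y i))"
  have eq: "\<sigma> * S = 2 * C"
  proof -
    have "(\<Sum>i\<in>I. w i * ((\<sigma> * x i - y i) * x i + (\<sigma> * y i - x i) * y i)) = \<sigma> * S - 2 * C"
      unfolding S_def C_def sum_distrib_left sum_subtractf[symmetric]
      by (intro sum.cong) (auto simp: algebra_simps power2_eq_square)
    then show ?thesis using stat by simp
  qed
  have diff: "(\<Sum>i\<in>I. w i * (x i - y i)\<^sup>2) = S - 2 * C"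
    unfolding S_def C_def sum_distrib_left sum_subtractf[symmetric]
    by (intro sum.cong) (auto simp: algebra_simps power2_eq_square)
  have "0 \<le> (\<Sum>i\<in>I. w i * (x i - y i)\<^sup>2)" by (intro sum_nonneg) (simp add: w)
  then have "\<sigma> * (\<sigma> * S) \<le> \<sigma> * S"
    using diff eq \<open>0 \<le> \<sigma>\<close> by (intro mult_left_mono) auto
  moreover have "(\<Sum>i\<in>I. w i * ((\<sigma> * x i - y i)\<^sup>2 + (\<sigma> * y i - x i)\<^sup>2))
      = \<sigma> * (\<sigma> * S) + S - 2 * \<sigma> * (2 * C)"
    unfolding S_def C_def sum_distrib_left sum_subtractf[symmetric] sum.distrib[symmetric]
    by (intro sum.cong) (auto simp: algebra_simps power2_eq_square)
  moreover have "2 * \<sigma> * (2 * C) = 2 * (\<sigma> * (\<sigma> * S))" using eq by simp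
  ultimately show ?thesis using diff eq by linarith
qed

section \<open>Coordinates in the singular bases\<close>

lemma transpose_mult_vec_component: "(transpose U *v z) $ j = inner z (column j U)"
  for U :: "real^'n^'m"
  by (simp add: matrix_vector_mul_component inner_commute transpose_def column_def inner_vec_def)

lemma norm_orthogonal_matrix_mult_vec:
  "orthogonal_matrix U \<Longrightarrow> norm (U *v z) = norm z" for U :: "real^'d^'d"
  using orthogonal_transformation_matrix[of "(*v) U"]
  by (simp add: orthogonal_transformation_norm)

lemma norm_power2_orthogonal_matrix:
  fixes U :: "real^'d^'d"
  assumes "orthogonal_matrix U"
  shows "(norm z)\<^sup>2 = (\<Sum>j\<in>UNIV. (inner z (column j U))\<^sup>2)"
proof -
  have "norm z = norm (transpose U *v z)"
    using assms by (intro norm_orthogonal_matrix_mult_vec[symmetric])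
      (simp add: orthogonal_matrix_transpose)
  then show ?thesis
    by (simp only: power2_norm_eq_inner inner_vec_def transpose_mult_vec_component)
      (simp add: power2_eq_square)
qed

lemma diagonal_mult_vec_component:
  fixes S :: "real^'d^'d"
  assumes "\<forall>i j. i \<noteq> j \<longrightarrow> S $ i $ j = 0"
  shows "(S *v z) $ j = S $ j $ j * z $ j"
proof -
  have "(\<Sum>k\<in>UNIV. S $ j $ k * z $ k) = (\<Sum>k\<in>UNIV. if k = j then S $ j $ j * z $ j else 0)"
    using assms by (intro sum.cong) auto
  then show ?thesis by (simp add: matrix_vector_mult_def)
qed

lemma is_svd_transpose: "is_svd A U S V \<Longrightarrow> is_svd (transpose A) V S U"
proof -
  assume svd: "is_svd A U S V"
  then have "transpose S $ i $ j = S $ i $ j" for i j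
    by (cases "i = j") (auto simp: is_svd_def transpose_def)
  then have "transpose S = S" by (simp add: vec_eq_iff)
  with svd show ?thesis
    by (auto simp: is_svd_def matrix_transpose_mul matrix_mul_assoc)
qed

lemma is_svd_inner_column:
  assumes "is_svd A U S V"
  shows "inner (A *v z) (column j U) = S $ j $ j * inner z (column j V)"
proof -
  have "A = U ** S ** transpose V" and U: "transpose U ** U = mat 1"
    and S: "\<forall>i j. i \<noteq> j \<longrightarrow> S $ i $ j = 0"
    using assms by (auto simp: is_svd_def orthogonal_matrix)
  then have "transpose U *v (A *v z) = S *v (transpose V *v z)"
    by (metis matrix_mul_assoc matrix_mul_lid matrix_vector_mul_assoc)
  then show ?thesis
    using diagonal_mult_vec_component[OF S] by (simp flip: transpose_mult_vec_component)
qed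

lemma inner_column_orthogonal_mult_transpose:
  fixes U V :: "real^'d^'d"
  assumes "orthogonal_matrix U"
  shows "inner ((U ** transpose V) *v z) (column j U) = inner z (column j V)"
proof -
  have "transpose U *v ((U ** transpose V) *v z) = transpose V *v z"
    using assms by (metis orthogonal_matrix matrix_mul_assoc matrix_mul_lid matrix_vector_mul_assoc)
  then show ?thesis by (simp flip: transpose_mult_vec_component)
qed

definition outer :: "real^'m \<Rightarrow> real^'n \<Rightarrow> real^'n^'m" where
  "outer u v = (\<chi> k l. u $ k * v $ l)"

lemma outer_mult_vec: "outer u v *v z = inner z v *\<^sub>R u"
  by (simp add: outer_def matrix_vector_mult_def vec_eq_iff inner_vec_def sum_distrib_left
      mult_ac)

section \<open>The residuals\<close>

definition res :: "real^'n^'d \<Rightarrow> real^'n^'d \<Rightarrow> real^'d^'d \<Rightarrow> real^'d \<Rightarrow> real^'d \<Rightarrow> 'n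
    \<Rightarrow> (real^'d) \<times> (real^'d)" where
  "res P Q A t s i = (A *v column i P - column i Q + t, transpose A *v column i Q - column i P + s)"

text \<open>The product norm of a pair is \<open>sqrt 2\<close> times the quadratic mean of the two
  norms.\<close>

lemma E_p_2_eq:
  fixes P Q :: "real^'n^'d"
  shows "E_p 2 P Q A t s = (\<Sum>i\<in>UNIV. norm (res P Q A t s i)) / sqrt 2"
proof -
  have "(2::ereal) \<noteq> \<infinity>" by simp
  moreover have "((norm a powr 2 + norm b powr 2) / 2) powr (1 / 2) = norm (a, b) / sqrt 2"
    for a b :: "real^'d"
    by (simp add: powr_half_sqrt norm_Pair real_sqrt_divide powr_numeral)
  ultimately show ?thesis
    by (simp add: E_p_def res_def sum_divide_distrib del: powr_numeral)
qed

text \<open>For matching singular vectors \<open>u\<close>, \<open>v\<close> this moves one diagonal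
  entry by \<open>h\<close>. The translations compensate so that a point with coordinates
  \<open>c\<close> and \<open>d\<close> keeps its residual.\<close>

lemma res_variation:
  "res P Q (A + h *\<^sub>R outer u v) (t - (h * c) *\<^sub>R u) (s - (h * d) *\<^sub>R v) i
    = res P Q A t s i
      + h *\<^sub>R ((inner (column i P) v - c) *\<^sub>R u, (inner (column i Q) u - d) *\<^sub>R v)"
proof -
  have "transpose (A + h *\<^sub>R outer u v) = transpose A + h *\<^sub>R outer v u"
    by (simp add: vec_eq_iff transpose_def outer_def)
  then show ?thesis
    by (simp add: res_def matrix_vector_mult_add_rdistrib scaleR_matrix_vector_assoc[symmetric]
        outer_mult_vec algebra_simps)
qed

definition proj_shift :: "real^'d^'d \<Rightarrow> real^'d^'d \<Rightarrow> real^'d^'d \<Rightarrow> real^'d \<Rightarrow> real^'d \<Rightarrow> real^'d" where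
  "proj_shift U S V t s
    = U *v (\<chi> j. (inner t (column j U) - inner s (column j V)) / (1 + S $ j $ j))"

text \<open>With coordinates \<open>x\<close>, \<open>y\<close> of the two points,
  \<open>a = \<sigma> * x - y + t\<close> and \<open>b = \<sigma> * y - x + s\<close> give
  \<open>a - b = (1 + \<sigma>) * (x - y) + t - s\<close>.\<close>

lemma inner_proj_residual:
  assumes svd: "is_svd A U S V"
  shows "inner ((U ** transpose V) *v column i P - column i Q + proj_shift U S V t s) (column j U)
    = (inner (fst (res P Q A t s i)) (column j U) - inner (snd (res P Q A t s i)) (column j V))
      / (1 + S $ j $ j)"
proof -
  have U: "orthogonal_matrix U" and "0 \<le> S $ j $ j" using svd by (auto simp: is_svd_def)
  then have nz: "1 + S $ j $ j \<noteq> 0" by simp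
  have "inner (U *v z) (column j U) = z $ j" for z
    using U by (metis orthogonal_matrix matrix_vector_mul_assoc matrix_vector_mul_lid
        transpose_mult_vec_component)
  then have "inner (proj_shift U S V t s) (column j U)
      = (inner t (column j U) - inner s (column j V)) / (1 + S $ j $ j)"
    by (simp add: proj_shift_def)
  then show ?thesis
    using nz inner_column_orthogonal_mult_transpose[OF U]
      is_svd_inner_column[OF svd] is_svd_inner_column[OF is_svd_transpose[OF svd]]
    by (simp add: res_def inner_add_left inner_diff_left field_simps)
qed

lemma norm_res_power2:
  assumes "is_svd A U S V"
  shows "(norm (res P Q A t s i))\<^sup>2
    = (\<Sum>j\<in>UNIV. (inner (fst (res P Q A t s i)) (column j U))\<^sup>2
        + (inner (snd (res P Q A t s i)) (column j V))\<^sup>2)"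
proof -
  have "orthogonal_matrix U" "orthogonal_matrix V" using assms by (auto simp: is_svd_def)
  then show ?thesis
    by (simp add: norm_prod_def sum.distrib flip: norm_power2_orthogonal_matrix)
qed

lemma norm_proj_residual_le:
  fixes P Q :: "real^'n^'d"
  assumes svd: "is_svd A U S V"
  shows "norm ((U ** transpose V) *v column i P - column i Q + proj_shift U S V t s)
    \<le> sqrt 2 * norm (res P Q A t s i)"
proof -
  let ?e = "(U ** transpose V) *v column i P - column i Q + proj_shift U S V t s"
  let ?a = "\<lambda>j. inner (fst (res P Q A t s i)) (column j U)"
  let ?b = "\<lambda>j. inner (snd (res P Q A t s i)) (column j V)"
  have U: "orthogonal_matrix U" and S: "\<And>j. 0 \<le> S $ j $ j" using svd by (auto simp: is_svd_def)
  have "(inner ?e (column j U))\<^sup>2 \<le> 2 * ((?a j)\<^sup>2 + (?b j)\<^sup>2)" for j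
  proof -
    have "(inner ?e (column j U))\<^sup>2 = (?a j - ?b j)\<^sup>2 / (1 + S $ j $ j)\<^sup>2"
      unfolding inner_proj_residual[OF svd] by (simp add: power_divide)
    also have "\<dots> \<le> (?a j - ?b j)\<^sup>2 / 1"
      using S[of j] by (intro divide_left_mono) (auto simp: one_le_power)
    also have "\<dots> \<le> 2 * ((?a j)\<^sup>2 + (?b j)\<^sup>2)"
      using zero_le_power2[of "?a j + ?b j"] by (simp add: power2_sum power2_diff)
    finally show ?thesis .
  qed
  then have "(norm ?e)\<^sup>2 \<le> (sqrt 2 * norm (res P Q A t s i))\<^sup>2"
    unfolding power_mult_distrib norm_power2_orthogonal_matrix[OF U] norm_res_power2[OF svd]
    by (simp add: sum_distrib_left sum_mono)
  then show ?thesis by (rule power2_le_imp_le) simp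
qed

text \<open>Absorbing the translations into a centre reduces coordinate \<open>j\<close> to the
  scalar problem of \<open>stationary_weighted_le\<close>.\<close>

lemma weighted_proj_residual_coordinate_le:
  fixes P Q :: "real^'n^'d" and A :: "real^'d^'d" and t s :: "real^'d"
  defines "r \<equiv> res P Q A t s"
  assumes min: "\<And>A' t' s'. (\<Sum>i\<in>UNIV. norm (r i)) \<le> (\<Sum>i\<in>UNIV. norm (res P Q A' t' s' i))"
    and svd: "is_svd A U S V"
  shows "(\<Sum>i\<in>UNIV. (inner ((U ** transpose V) *v column i P - column i Q
        + proj_shift U S V t s) (column j U))\<^sup>2 / norm (r i))
    \<le> (\<Sum>i\<in>UNIV. ((inner (fst (r i)) (column j U))\<^sup>2
        + (inner (snd (r i)) (column j V))\<^sup>2) / norm (r i))"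
proof -
  define \<sigma> where "\<sigma> = S $ j $ j"
  define u v where "u = column j U" and "v = column j V"
  define x y where "x i = inner (column i P) v" and "y i = inner (column i Q) u" for i
  define a b where "a i = inner (fst (r i)) u" and "b i = inner (snd (r i)) v" for i
  have \<sigma>: "0 \<le> \<sigma>" using svd by (simp add: is_svd_def \<sigma>_def)
  have a: "a i = \<sigma> * x i - y i + inner t u" and b: "b i = \<sigma> * y i - x i + inner s v" for i
    using is_svd_inner_column[OF svd] is_svd_inner_column[OF is_svd_transpose[OF svd]]
    by (simp_all add: a_def b_def r_def res_def x_def y_def \<sigma>_def u_def v_def
        inner_add_left inner_diff_left)
  have e: "inner ((U ** transpose V) *v column i P - column i Q + proj_shift U S V t s) u
      = (a i - b i) / (1 + \<sigma>)" for i
    using inner_proj_residual[OF svd] by (simp add: a_def b_def u_def v_def \<sigma>_def r_def)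
  have "(\<Sum>i\<in>UNIV. ((a i - b i) / (1 + \<sigma>))\<^sup>2 / norm (r i))
      \<le> (\<Sum>i\<in>UNIV. ((a i)\<^sup>2 + (b i)\<^sup>2) / norm (r i))"
  proof (cases "\<sigma> = 1")
    case True
    \<comment> \<open>For \<open>\<sigma> = 1\<close> the system for the centre is singular, but the
      denominator is 2 and a pointwise bound suffices.\<close>
    have "((a i - b i) / (1 + \<sigma>))\<^sup>2 \<le> (a i)\<^sup>2 + (b i)\<^sup>2" for i
    proof -
      have "(a i - b i)\<^sup>2 \<le> (a i - b i)\<^sup>2 + (a i + b i)\<^sup>2 + 2 * ((a i)\<^sup>2 + (b i)\<^sup>2)"
        by simp
      also have "\<dots> = 4 * ((a i)\<^sup>2 + (b i)\<^sup>2)"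
        by (simp add: power2_sum power2_diff)
      finally show ?thesis using True by (simp add: power_divide)
    qed
    then show ?thesis by (intro sum_mono divide_right_mono) auto
  next
    case False
    with \<sigma> have nz: "1 - \<sigma>\<^sup>2 \<noteq> 0" by (simp add: power2_eq_1_iff)
    \<comment> \<open>The centre: the residuals of the scalar problem vanish at \<open>x = c\<close>, \<open>y = d\<close>, and only there.\<close>
    define c d where "c = (inner s v + \<sigma> * inner t u) / (1 - \<sigma>\<^sup>2)"
      and "d = (inner t u + \<sigma> * inner s v) / (1 - \<sigma>\<^sup>2)"
    have cd: "(1 - \<sigma>\<^sup>2) * c = inner s v + \<sigma> * inner t u"
        "(1 - \<sigma>\<^sup>2) * d = inner t u + \<sigma> * inner s v"
      using nz by (simp_all add: c_def d_def)
    have t: "inner t u = d - \<sigma> * c" and s: "inner s v = c - \<sigma> * d"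
    proof -
      have "(1 - \<sigma>\<^sup>2) * inner t u = (1 - \<sigma>\<^sup>2) * (d - \<sigma> * c)"
        using cd by (simp add: right_diff_distrib mult.left_commute[of _ \<sigma>])
          (simp add: algebra_simps power2_eq_square)
      then show "inner t u = d - \<sigma> * c" using nz by simp
      have "(1 - \<sigma>\<^sup>2) * inner s v = (1 - \<sigma>\<^sup>2) * (c - \<sigma> * d)"
        using cd by (simp add: right_diff_distrib mult.left_commute[of _ \<sigma>])
          (simp add: algebra_simps power2_eq_square)
      then show "inner s v = c - \<sigma> * d" using nz by simp
    qed
    define X Y where "X i = x i - c" and "Y i = y i - d" for i
    have aX: "a i = \<sigma> * X i - Y i" and bX: "b i = \<sigma> * Y i - X i" for i
      by (simp_all add: a b t s X_def Y_def algebra_simps)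
    define \<delta> where "\<delta> i = (X i *\<^sub>R u, Y i *\<^sub>R v)" for i
    have "(\<Sum>i\<in>UNIV. inner (r i) (\<delta> i) / norm (r i)) = 0"
    proof (rule stationary_sum_norm)
      show "(\<Sum>i\<in>UNIV. norm (r i)) \<le> (\<Sum>i\<in>UNIV. norm (r i + h *\<^sub>R \<delta> i))" for h
        using min[of "A + h *\<^sub>R outer u v" "t - (h * c) *\<^sub>R u" "s - (h * d) *\<^sub>R v"]
        by (simp add: res_variation r_def \<delta>_def X_def Y_def x_def y_def)
      show "\<delta> i = 0" if "r i = 0" for i
      proof -
        have "a i = 0" "b i = 0" using that by (simp_all add: a_def b_def)
        \<comment> \<open>Inverting the 2 by 2 system shows that a zero residual puts the point at
          the centre.\<close>
        moreover have "(1 - \<sigma>\<^sup>2) * X i = - (b i + \<sigma> * a i)" "(1 - \<sigma>\<^sup>2) * Y i = - (a i + \<sigma> * b i)"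
          by (simp_all add: aX bX algebra_simps power2_eq_square)
        ultimately have "X i = 0" "Y i = 0" using nz by simp_all
        then show ?thesis by (simp add: \<delta>_def zero_prod_def)
      qed
    qed
    moreover have "inner (r i) (\<delta> i) = (\<sigma> * X i - Y i) * X i + (\<sigma> * Y i - X i) * Y i" for i
      by (simp add: \<delta>_def inner_prod_def flip: a_def b_def aX bX)
    \<comment> \<open>Since \<open>inverse 0 = 0\<close>, points with zero residual get weight
      0.\<close>
    ultimately have "(\<Sum>i\<in>UNIV. inverse (norm (r i))
        * ((\<sigma> * X i - Y i) * X i + (\<sigma> * Y i - X i) * Y i)) = 0"
      by (simp add: divide_inverse mult.commute)
    then have "(\<Sum>i\<in>UNIV. inverse (norm (r i)) * (X i - Y i)\<^sup>2)
        \<le> (\<Sum>i\<in>UNIV. inverse (norm (r i)) * ((\<sigma> * X i - Y i)\<^sup>2 + (\<sigma> * Y i - X i)\<^sup>2))"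
      using \<sigma> by (rule stationary_weighted_le) simp
    moreover have "(a i - b i) / (1 + \<sigma>) = X i - Y i" for i
      using \<sigma> by (simp add: aX bX field_simps)
    ultimately show ?thesis
      by (simp add: divide_inverse mult.commute flip: aX bX)
  qed
  then show ?thesis
    by (simp add: e a_def b_def flip: u_def v_def)
qed

lemma E_proj_le_sum_norm_res:
  fixes P Q :: "real^'n^'d"
  assumes min: "\<And>A' t' s'. (\<Sum>i\<in>UNIV. norm (res P Q A t s i))
      \<le> (\<Sum>i\<in>UNIV. norm (res P Q A' t' s' i))"
    and svd: "is_svd A U S V"
  shows "E P Q (U ** transpose V) (proj_shift U S V t s) \<le> (\<Sum>i\<in>UNIV. norm (res P Q A t s i))"
  unfolding E_def
proof (rule sum_norm_le_if_weighted_le)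
  have U: "orthogonal_matrix U" using svd by (simp add: is_svd_def)
  show "(\<Sum>i\<in>UNIV. (norm ((U ** transpose V) *v column i P - column i Q
        + proj_shift U S V t s))\<^sup>2 / norm (res P Q A t s i))
      \<le> (\<Sum>i\<in>UNIV. (norm (res P Q A t s i))\<^sup>2 / norm (res P Q A t s i))"
    unfolding norm_power2_orthogonal_matrix[OF U] norm_res_power2[OF svd] sum_divide_distrib
    \<comment> \<open>With the coordinate sum outermost, the inequality holds for each
      \<open>j\<close> separately.\<close>
    by (subst (1 2) sum.swap)
      (intro sum_mono weighted_proj_residual_coordinate_le[OF min svd])
  show "(U ** transpose V) *v column i P - column i Q + proj_shift U S V t s = 0"
    if "res P Q A t s i = 0" for i
    using norm_proj_residual_le[OF svd, of i P Q t s] that by simp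
qed

section \<open>Comparison of the functionals\<close>

text \<open>Dropping the smaller power costs a factor \<open>2 powr (1 / r)\<close>, at most
  \<open>sqrt 2\<close> because \<open>2 \<le> r\<close>.\<close>

lemma max_le_power_mean:
  fixes x y r :: real
  assumes "0 \<le> x" "0 \<le> y" "2 \<le> r"
  shows "max x y \<le> sqrt 2 * ((x powr r + y powr r) / 2) powr (1 / r)"
proof -
  define m where "m = max x y"
  have m: "0 \<le> m" using assms by (simp add: m_def)
  have "(1 / 2 :: real) powr (1 / 2) \<le> (1 / 2) powr (1 / r)"
    using assms by (intro powr_mono') (auto simp: field_simps)
  then have half: "1 / sqrt 2 \<le> (1 / 2 :: real) powr (1 / r)"
    by (simp add: powr_half_sqrt real_sqrt_divide)
  have "m * (1 / sqrt 2) \<le> m * (1 / 2) powr (1 / r)"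
    using m half by (rule mult_left_mono[rotated])
  also have "\<dots> = (m powr r / 2) powr (1 / r)"
    using m assms by (simp add: powr_divide powr_powr)
  also have "\<dots> \<le> ((x powr r + y powr r) / 2) powr (1 / r)"
    using assms by (intro powr_mono2 divide_right_mono) (auto simp: m_def max_def)
  finally show ?thesis
    unfolding m_def by (simp add: field_simps)
qed

text \<open>The 2 is a product of two factors \<open>sqrt 2\<close>: from the pair norm to the
  maximum, and from the maximum to the mean.\<close>

lemma sum_norm_res_le_E_p:
  fixes P Q :: "real^'n^'d"
  assumes "2 \<le> p"
  shows "(\<Sum>i\<in>UNIV. norm (res P Q A t s i)) \<le> 2 * E_p p P Q A t s"
proof -
  have norm_max: "norm (a, b) \<le> sqrt 2 * max (norm a) (norm b)" for a b :: "real^'d"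
  proof -
    have "(norm a)\<^sup>2 \<le> (max (norm a) (norm b))\<^sup>2" "(norm b)\<^sup>2 \<le> (max (norm a) (norm b))\<^sup>2"
      by (auto intro!: power_mono)
    then have "(norm a)\<^sup>2 + (norm b)\<^sup>2 \<le> (sqrt 2 * max (norm a) (norm b))\<^sup>2"
      unfolding power_mult_distrib by simp
    then show ?thesis unfolding norm_Pair by (rule real_le_lsqrt[rotated -1]) (auto simp: le_max_iff_disj)
  qed
  show ?thesis
  proof (cases "p = \<infinity>")
    case True
    have "norm (a, b) \<le> 2 * max (norm a) (norm b)" for a b :: "real^'d"
    proof -
      have "sqrt 2 * max (norm a) (norm b) \<le> 2 * max (norm a) (norm b)"
        by (intro mult_right_mono) (auto simp: le_max_iff_disj sqrt2_less_2 less_imp_le)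
      with norm_max[of a b] show ?thesis by linarith
    qed
    with True show ?thesis
      by (simp add: E_p_def res_def sum_distrib_left sum_mono)
  next
    case False
    with assms obtain r where r: "p = ereal r" by (cases p) auto
    then have "2 \<le> r" using assms
      by (metis ereal_less_eq(3) numeral_eq_ereal)
    have "norm (a, b) \<le> 2 * ((norm a powr r + norm b powr r) / 2) powr (1 / r)" for a b :: "real^'d"
    proof -
      have "sqrt 2 * max (norm a) (norm b)
          \<le> sqrt 2 * (sqrt 2 * ((norm a powr r + norm b powr r) / 2) powr (1 / r))"
        using \<open>2 \<le> r\<close> by (intro mult_left_mono max_le_power_mean) auto
      with norm_max[of a b] show ?thesis by (simp flip: mult.assoc)
    qed
    with r show ?thesis
      by (simp add: E_p_def res_def Let_def sum_distrib_left sum_mono)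
  qed
qed

text \<open>For this \<open>s\<close> the second residual is \<open>- transpose R\<close> applied to
  the first, so both norms agree and their mean is the common value.\<close>

lemma E_p_orthogonal_eq_E:
  assumes "orthogonal_matrix R" "2 \<le> p"
  shows "E_p p P Q R t (- (transpose R *v t)) = E P Q R t"
proof -
  have RT: "orthogonal_matrix (transpose R)" and "transpose R ** R = mat 1"
    using assms(1) by (simp add: orthogonal_matrix_transpose, simp add: orthogonal_matrix)
  then have "transpose R *v (R *v z) = z" for z by (simp add: matrix_vector_mul_assoc)
  then have "transpose R *v y - x + - (transpose R *v t) = - (transpose R *v (R *v x - y + t))"
    for x y by (simp add: matrix_vector_right_distrib matrix_vector_mult_diff_distrib)
  then have norm_eq: "norm (transpose R *v y - x + - (transpose R *v t)) = norm (R *v x - y + t)"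
    for x y using norm_orthogonal_matrix_mult_vec[OF RT] by (simp del: add_uminus_conv_diff)
  show ?thesis
  proof (cases "p = \<infinity>")
    case True
    then show ?thesis unfolding E_p_def E_def norm_eq by simp
  next
    case False
    with assms obtain r where r: "p = ereal r" by (cases p) auto
    then have "2 \<le> r" using assms(2) by (metis ereal_less_eq(3) numeral_eq_ereal)
    with r show ?thesis unfolding E_p_def E_def norm_eq by (simp add: Let_def powr_powr)
  qed
qed

theorem theorem3p2:
  fixes P Q :: "real^'n^'d"
    and p :: ereal
    and A Rhat :: "real^'d^'d"
    and t s that :: "real^'d"
  assumes "2 \<le> p"
    and "is_arg_min (\<lambda>(A, t, s). E_p p P Q A t s) (\<lambda>_. True) (A, t, s)"
    and "is_Pi A Rhat"
    and "is_arg_min (\<lambda>t. E P Q Rhat t) (\<lambda>_. True) that"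
  shows "(E_star P Q \<le> E P Q Rhat that \<and>
          E P Q Rhat that \<le> 2 * sqrt 2 * E_p p P Q A t s \<and>
          2 * sqrt 2 * E_p p P Q A t s \<le> 2 * sqrt 2 * E_star P Q) \<and>
         (p = 2 \<longrightarrow>
          E_star P Q \<le> E P Q Rhat that \<and>
          E P Q Rhat that \<le> sqrt 2 * E_p 2 P Q A t s \<and>
          sqrt 2 * E_p 2 P Q A t s \<le> sqrt 2 * E_star P Q)"
proof -
  have minA: "E_p p P Q A t s \<le> E_p p P Q A' t' s'" for A' t' s'
    using assms(2) by (auto simp: is_arg_min_linorder)
  have mint: "E P Q Rhat that \<le> E P Q Rhat t'" for t'
    using assms(4) by (auto simp: is_arg_min_linorder)
  obtain U S V where svd: "is_svd A U S V" and Rhat: "Rhat = U ** transpose V"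
    using assms(3) by (auto simp: is_Pi_def)
  have "orthogonal_matrix Rhat"
    using svd unfolding Rhat is_svd_def by (intro orthogonal_matrix_mul) auto
  obtain R0 t0 where R0: "orthogonal_matrix R0" "E P Q R0 t0 = E_star P Q"
    and min0: "\<And>R' t'. orthogonal_matrix R' \<Longrightarrow> E P Q R0 t0 \<le> E P Q R' t'"
    using E_star_attained[of P Q] by metis
  have lower: "E_star P Q \<le> E P Q Rhat that"
    using min0[OF \<open>orthogonal_matrix Rhat\<close>] R0(2) by simp
  \<comment> \<open>The optimal orthogonal pair, completed by this \<open>s\<close>, competes in the
    relaxed problem.\<close>
  have upper: "E_p p P Q A t s \<le> E_star P Q"
    using minA[of R0 t0 "- (transpose R0 *v t0)"] E_p_orthogonal_eq_E[OF R0(1) assms(1)] R0(2)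
    by metis
  have "E P Q Rhat that \<le> sqrt 2 * (\<Sum>i\<in>UNIV. norm (res P Q A t s i))"
  proof -
    have "E P Q Rhat that \<le> E P Q Rhat (proj_shift U S V t s)" by (rule mint)
    also have "\<dots> \<le> sqrt 2 * (\<Sum>i\<in>UNIV. norm (res P Q A t s i))"
      unfolding E_def Rhat sum_distrib_left by (intro sum_mono norm_proj_residual_le svd)
    finally show ?thesis .
  qed
  also have "\<dots> \<le> sqrt 2 * (2 * E_p p P Q A t s)"
    using sum_norm_res_le_E_p[OF assms(1)] by (intro mult_left_mono) auto
  finally have general: "E P Q Rhat that \<le> 2 * sqrt 2 * E_p p P Q A t s" by simp
  have "E P Q Rhat that \<le> sqrt 2 * E_p 2 P Q A t s" if "p = 2"
  proof -
    have "(\<Sum>i\<in>UNIV. norm (res P Q A t s i)) \<le> (\<Sum>i\<in>UNIV. norm (res P Q A' t' s' i))" for A' t' s'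
      using minA[of A' t' s', unfolded \<open>p = 2\<close> E_p_2_eq] by (simp add: divide_le_cancel)
    then have "E P Q Rhat (proj_shift U S V t s) \<le> (\<Sum>i\<in>UNIV. norm (res P Q A t s i))"
      unfolding Rhat using svd by (rule E_proj_le_sum_norm_res)
    then show ?thesis using mint[of "proj_shift U S V t s"] unfolding E_p_2_eq by simp
  qed
  then show ?thesis using lower upper general by auto
qed

end
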